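(* Let $P,Q$ be proper upward monotone quantifiers on a nonempty set $D$. Then $$(P\cdot Q)^d=P^d\cdot Q^d,$$ $$P\boxtimes Q\subseteq P\cdot Q\subseteq (P^d\boxtimes Q^d)^d.$$ Moreover, $P$ dominates $Q$ if and only if $Q^d$ dominates $P^d$.
   Context: A (unary) quantifier on a nonempty set $D$ is a family $Q\subseteq\mathcal P(D)$. It is upward monotone if $A\in Q$ and $A\subseteq B\subseteq D$ imply $B\in Q$; it is proper if $\varnothing\notin Q$ and $D\in Q$. For $R\subseteq D^2$ put $R_x=\{y\in D:(x,y)\in R\}$ and $R^{-1}=\{(y,x):(x,y)\in R\}$. The iteration is $P\cdot Q=\{R\subseteq D^2:\{x\in D:R_x\in Q\}\in P\}$. $P$ dominates $Q$ if for every $R\subseteq D^2$, $R\in P\cdot Q$ implies $R^{-1}\in Q\cdot P$. The branching product is $P\boxtimes Q=\{R\subseteq D^2:\exists A\in P\ \exists B\in Q\ (A\times B\subseteq R)\}$. The dual of a unary quantifier $Q$ is $Q^d=\{A\subseteq D:D\setminus A\notin Q\}$; the dual of a binary quantifier $\mathcal Q\subseteq\mathcal P(D^2)$ is $\mathcal Q^d=\{R\subseteq D^2:D^2\setminus R\notin\mathcal Q\}$. *)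

theory Defs
  imports Main
begin

definition quantifier_on :: "'a set \<Rightarrow> 'a set set \<Rightarrow> bool" where
  "quantifier_on D Q \<longleftrightarrow> Q \<subseteq> Pow D"

definition upward_monotone :: "'a set \<Rightarrow> 'a set set \<Rightarrow> bool" where
  "upward_monotone D Q \<longleftrightarrow> (\<forall>A B. A \<in> Q \<longrightarrow> A \<subseteq> B \<longrightarrow> B \<subseteq> D \<longrightarrow> B \<in> Q)"

definition proper :: "'a set \<Rightarrow> 'a set set \<Rightarrow> bool" where
  "proper D Q \<longleftrightarrow> {} \<notin> Q \<and> D \<in> Q"

definition section_at :: "'a set \<Rightarrow> 'a rel \<Rightarrow> 'a \<Rightarrow> 'a set" where
  "section_at D R x = {y \<in> D. (x, y) \<in> R}"

definition iteration :: "'a set \<Rightarrow> 'a set set \<Rightarrow> 'a set set \<Rightarrow> 'a rel set" where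
  "iteration D P Q = {R. R \<subseteq> D \<times> D \<and> {x \<in> D. section_at D R x \<in> Q} \<in> P}"

definition dominates :: "'a set \<Rightarrow> 'a set set \<Rightarrow> 'a set set \<Rightarrow> bool" where
  "dominates D P Q \<longleftrightarrow>
     (\<forall>R. R \<subseteq> D \<times> D \<longrightarrow> R \<in> iteration D P Q \<longrightarrow> R\<inverse> \<in> iteration D Q P)"

definition branching :: "'a set \<Rightarrow> 'a set set \<Rightarrow> 'a set set \<Rightarrow> 'a rel set" where
  "branching D P Q = {R. R \<subseteq> D \<times> D \<and> (\<exists>A\<in>P. \<exists>B\<in>Q. A \<times> B \<subseteq> R)}"

(* The dual is taken relative to an ambient set U: U = D for a unary quantifier on D,
   and U = D \<times> D for a binary one. *)
definition dual :: "'u set \<Rightarrow> 'u set set \<Rightarrow> 'u set set" where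
  "dual U Q = {A. A \<subseteq> U \<and> U - A \<notin> Q}"

end

theory Submission
  imports Defs
begin

text \<open>Everything rests on the identity \<open>iteration_dual\<close>: complementing a relation complements each
  of its sections, so the two negations hidden in the dual of the inner quantifier and in the dual
  of the outer one can be gathered into a single negation in front of the iteration. The upper
  bound for \<open>P \<cdot> Q\<close> is then the lower bound applied to the duals: the branching product of the duals
  lies in the iteration of the duals, that is in the dual of \<open>P \<cdot> Q\<close>, and dualizing reverses the
  inclusion. Dominance is an inclusion between iterations up to taking converses; since the
  complement commutes with the converse, dualizing reverses it as well, and because the dual is an
  involution one implication gives the equivalence.\<close>

lemma section_at_Diff:
  assumes "x \<in> D"
  shows "section_at D (D \<times> D - R) x = D - section_at D R x"
  using assms by (auto simp: section_at_def)

lemma dual_dual: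
  assumes "quantifier_on D Q"
  shows "dual D (dual D Q) = Q"
  using assms by (auto simp: dual_def quantifier_on_def double_diff)

lemma quantifier_on_dual: "quantifier_on D (dual D Q)"
  by (auto simp: dual_def quantifier_on_def)

lemma upward_monotone_dual:
  assumes "upward_monotone D Q"
  shows "upward_monotone D (dual D Q)"
  unfolding upward_monotone_def
proof (intro allI impI)
  fix A B assume A: "A \<in> dual D Q" and AB: "A \<subseteq> B" and BD: "B \<subseteq> D"
  have "D - B \<notin> Q"
  proof
    assume "D - B \<in> Q"
    moreover have "D - B \<subseteq> D - A" using AB by blast
    ultimately have "D - A \<in> Q"
      using assms unfolding upward_monotone_def by blast
    then show False using A by (simp add: dual_def)
  qed
  then show "B \<in> dual D Q" using BD by (simp add: dual_def)
qed

lemma iteration_dual: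
  "dual (D \<times> D) (iteration D P Q) = iteration D (dual D P) (dual D Q)"
proof -
  have "D - {x \<in> D. section_at D R x \<in> dual D Q}
      = {x \<in> D. section_at D (D \<times> D - R) x \<in> Q}" for R
    by (auto simp: section_at_Diff dual_def) (auto simp: section_at_def)
  then show ?thesis
    by (auto simp: iteration_def dual_def)
qed

text \<open>A rectangle \<open>A \<times> B\<close> inside \<open>R\<close> makes every section of \<open>R\<close> over \<open>A\<close> a superset of \<open>B\<close>.\<close>

lemma branching_subset_iteration:
  assumes P: "quantifier_on D P" "upward_monotone D P"
    and Q: "quantifier_on D Q" "upward_monotone D Q"
  shows "branching D P Q \<subseteq> iteration D P Q"
proof
  fix R assume "R \<in> branching D P Q"
  then obtain A B where R: "R \<subseteq> D \<times> D" and A: "A \<in> P" and B: "B \<in> Q" and AB: "A \<times> B \<subseteq> R"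
    by (auto simp: branching_def)
  have AD: "A \<subseteq> D" and BD: "B \<subseteq> D"
    using A B P(1) Q(1) by (auto simp: quantifier_on_def)
  have "section_at D R x \<in> Q" if "x \<in> A" for x
  proof -
    have "B \<subseteq> section_at D R x" "section_at D R x \<subseteq> D"
      using that AB BD by (auto simp: section_at_def)
    then show ?thesis using B Q(2) unfolding upward_monotone_def by blast
  qed
  then have "A \<subseteq> {x \<in> D. section_at D R x \<in> Q}" using AD by blast
  moreover have "{x \<in> D. section_at D R x \<in> Q} \<subseteq> D" by blast
  ultimately have "{x \<in> D. section_at D R x \<in> Q} \<in> P"
    using A P(2) unfolding upward_monotone_def by blast
  then show "R \<in> iteration D P Q" using R by (simp add: iteration_def)
qed

lemma iteration_subset_dual_branching:
  assumes P: "upward_monotone D P" and Q: "upward_monotone D Q"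
  shows "iteration D P Q \<subseteq> dual (D \<times> D) (branching D (dual D P) (dual D Q))"
proof
  fix R assume R: "R \<in> iteration D P Q"
  then have RD: "R \<subseteq> D \<times> D" by (simp add: iteration_def)
  have "branching D (dual D P) (dual D Q) \<subseteq> dual (D \<times> D) (iteration D P Q)"
    unfolding iteration_dual
    by (intro branching_subset_iteration quantifier_on_dual upward_monotone_dual P Q)
  moreover have "D \<times> D - R \<notin> dual (D \<times> D) (iteration D P Q)"
    using R RD by (simp add: dual_def double_diff)
  ultimately show "R \<in> dual (D \<times> D) (branching D (dual D P) (dual D Q))"
    using RD by (auto simp: dual_def)
qed

text \<open>This is contraposition: a counterexample \<open>R\<close> to dominance of the duals gives the
  counterexample \<open>D \<times> D - R\<inverse>\<close> to dominance of \<open>Q\<close> by \<open>P\<close>.\<close>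

lemma dominates_dual:
  assumes dom: "dominates D P Q"
  shows "dominates D (dual D Q) (dual D P)"
  unfolding dominates_def iteration_dual[symmetric]
proof (intro allI impI)
  fix R assume RD: "R \<subseteq> D \<times> D" and R: "R \<in> dual (D \<times> D) (iteration D Q P)"
  have conv: "(D \<times> D - R\<inverse>)\<inverse> = D \<times> D - R" by blast
  have "D \<times> D - R\<inverse> \<notin> iteration D P Q"
  proof
    assume "D \<times> D - R\<inverse> \<in> iteration D P Q"
    then have "(D \<times> D - R\<inverse>)\<inverse> \<in> iteration D Q P"
      using dom unfolding dominates_def by blast
    then show False using R unfolding conv by (simp add: dual_def)
  qed
  then show "R\<inverse> \<in> dual (D \<times> D) (iteration D P Q)"
    using RD by (auto simp: dual_def)
qed

theorem proposition2p4:
  fixes D :: "'a set" and P Q :: "'a set set"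
  assumes "D \<noteq> {}"
    and "quantifier_on D P" and "upward_monotone D P" and "proper D P"
    and "quantifier_on D Q" and "upward_monotone D Q" and "proper D Q"
  shows "dual (D \<times> D) (iteration D P Q) = iteration D (dual D P) (dual D Q)
    \<and> branching D P Q \<subseteq> iteration D P Q
    \<and> iteration D P Q \<subseteq> dual (D \<times> D) (branching D (dual D P) (dual D Q))
    \<and> (dominates D P Q \<longleftrightarrow> dominates D (dual D Q) (dual D P))"
proof (intro conjI)
  show "dual (D \<times> D) (iteration D P Q) = iteration D (dual D P) (dual D Q)"
    by (rule iteration_dual)
  show "branching D P Q \<subseteq> iteration D P Q"
    using assms by (intro branching_subset_iteration)
  show "iteration D P Q \<subseteq> dual (D \<times> D) (branching D (dual D P) (dual D Q))"
    using assms by (intro iteration_subset_dual_branching)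
  show "dominates D P Q \<longleftrightarrow> dominates D (dual D Q) (dual D P)"
    using dominates_dual[of D P Q] dominates_dual[of D "dual D Q" "dual D P"]
      dual_dual[OF assms(2)] dual_dual[OF assms(5)]
    by auto
qed

end
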